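(* (1) Let $(R,\{\partial_m\mid m\geq0\})$ be a setting for the AKNS hierarchy and let $Q=gQ_0g^{-1}$ with $g\in G_{<0}$. Assume that the projections $B_m:=(Qz^m)_{\geq0}$, $m\geq0$, satisfy the zero curvature relations $$\partial_{m_1}(B_{m_2})-\partial_{m_2}(B_{m_1})-[B_{m_1},B_{m_2}]=0\quad\text{for all }m_1,m_2\geq0.$$ Then $Q$ is a solution of the AKNS hierarchy. (2) Let $(R,\{\partial_m\mid m\geq1\})$ be a setting for the strict AKNS hierarchy and let $Z=KgQ_0z\,g^{-1}K^{-1}$ with $K\in\mathrm{gl}_2(R)^*$ and $g\in G_{<0}$. Assume that the projections $C_m:=(Zz^{m-1})_{>0}$, $m\geq1$, satisfy the zero curvature relations $$\partial_{m_1}(C_{m_2})-\partial_{m_2}(C_{m_1})-[C_{m_1},C_{m_2}]=0\quad\text{for all }m_1,m_2\geq1.$$ Then $Z$ is a solution of the strict AKNS hierarchy.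
   Context: A setting for the AKNS (resp. strict AKNS) hierarchy is a commutative complex algebra $R$ together with a set of commuting $\mathbb{C}$-linear derivations $\partial_m:R\to R$, $m\geq0$ (resp. $m\geq1$). $\mathrm{gl}_2(R)[z,z^{-1})$ is the algebra of series $X=\sum_{i=-\infty}^NX_iz^i$ with $X_i\in\mathrm{gl}_2(R)$, $N\in\mathbb{Z}$, with bracket $[X,Y]=\sum_{i,j}[X_i,Y_j]z^{i+j}$; each $\partial_m$ acts on it coefficientwise. Put $(X)_{\geq0}=\sum_{i\geq0}X_iz^i$ and $(X)_{>0}=\sum_{i\geq1}X_iz^i$. Let $Q_0=\begin{pmatrix}-i&0\\0&i\end{pmatrix}$, $G_{<0}=\{\mathrm{Id}+\sum_{j\geq1}Y_jz^{-j}\mid Y_j\in\mathrm{gl}_2(R)\}$, and let $\mathrm{gl}_2(R)^*$ be the invertible elements of $\mathrm{gl}_2(R)$. An element $Q=gQ_0g^{-1}$ ($g\in G_{<0}$) is a solution of the AKNS hierarchy if $\partial_m(Q)=[(Qz^m)_{\geq0},Q]$ for all $m\geq0$. An element $Z=KgQ_0z\,g^{-1}K^{-1}$ ($K\in\mathrm{gl}_2(R)^*$, $g\in G_{<0}$) is a solution of the strict AKNS hierarchy if $\partial_m(Z)=[(Zz^{m-1})_{>0},Z]$ for all $m\geq1$. *)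

theory Defs
  imports "HOL-Analysis.Analysis" "HOL-Computational_Algebra.Formal_Laurent_Series"
begin

section \<open>Commutative complex algebras with commuting derivations\<close>

text \<open>The complex algebra structure is an explicit scalar multiplication on a type of class
  \<^class>\<open>comm_ring_1\<close>. A family of derivations is a function on all naturals, of which only the
  members with index in \<open>M\<close> are constrained.\<close>

locale complex_algebra = vector_space cscale
  for cscale :: "complex \<Rightarrow> 'r::comm_ring_1 \<Rightarrow> 'r" +
  assumes scale_mult: "cscale c (x * y) = cscale c x * y"

locale derivation = complex_algebra cscale + Vector_Spaces.linear cscale cscale D
  for cscale :: "complex \<Rightarrow> 'r::comm_ring_1 \<Rightarrow> 'r" and D :: "'r \<Rightarrow> 'r" +
  assumes Leibniz: "D (x * y) = D x * y + x * D y"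

locale commuting_derivations = complex_algebra cscale
  for cscale :: "complex \<Rightarrow> 'r::comm_ring_1 \<Rightarrow> 'r" +
  fixes D :: "nat \<Rightarrow> 'r \<Rightarrow> 'r" and M :: "nat set"
  assumes derivation: "m \<in> M \<Longrightarrow> derivation cscale (D m)"
    and commute: "m \<in> M \<Longrightarrow> n \<in> M \<Longrightarrow> D m (D n x) = D n (D m x)"

definition akns_setting :: "(complex \<Rightarrow> 'r::comm_ring_1 \<Rightarrow> 'r) \<Rightarrow> (nat \<Rightarrow> 'r \<Rightarrow> 'r) \<Rightarrow> bool"
  where "akns_setting cscale D \<longleftrightarrow> commuting_derivations cscale D {0..}"

definition strict_akns_setting :: "(complex \<Rightarrow> 'r::comm_ring_1 \<Rightarrow> 'r) \<Rightarrow> (nat \<Rightarrow> 'r \<Rightarrow> 'r) \<Rightarrow> bool"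
  where "strict_akns_setting cscale D \<longleftrightarrow> commuting_derivations cscale D {1..}"


section \<open>Commutators and inverses in rings\<close>

definition commutator :: "'a::ring \<Rightarrow> 'a \<Rightarrow> 'a"
  where "commutator x y = x * y - y * x"

definition is_inverse :: "'a::monoid_mult \<Rightarrow> 'a \<Rightarrow> bool"
  where "is_inverse x y \<longleftrightarrow> x * y = 1 \<and> y * x = 1"

definition unit_set :: "'a::monoid_mult set"
  where "unit_set = {x. \<exists>y. is_inverse x y}"

definition ring_inverse :: "'a::monoid_mult \<Rightarrow> 'a"
  where "ring_inverse x = (THE y. is_inverse x y)"

lemma ring_inverse_unique: "is_inverse x y \<Longrightarrow> ring_inverse x = y"
  unfolding ring_inverse_def
proof (rule the_equality)
  fix w assume "is_inverse x y" "is_inverse x w"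
  then have "w * (x * y) = w" and "(w * x) * y = y"
    by (simp_all add: is_inverse_def)
  then show "w = y" by (simp add: mult.assoc)
qed

lemma is_inverse_ring_inverse: "x \<in> unit_set \<Longrightarrow> is_inverse x (ring_inverse x)"
  using ring_inverse_unique by (auto simp: unit_set_def)


section \<open>The matrix ring\<close>

text \<open>On \<^typ>\<open>'r^2^2\<close> the operation \<open>*\<close> is the entrywise product, so a copy of the type is
  used, on which \<open>*\<close> is the matrix product.\<close>

typedef 'r gl2 = "UNIV :: ('r^2^2) set"
  morphisms entries Gl2 by simp

setup_lifting type_definition_gl2

instantiation gl2 :: (comm_ring_1) ring_1
begin

lift_definition zero_gl2 :: "'a gl2" is 0 .
lift_definition one_gl2 :: "'a gl2" is "mat 1" .
lift_definition plus_gl2 :: "'a gl2 \<Rightarrow> 'a gl2 \<Rightarrow> 'a gl2" is "(+)" .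
lift_definition minus_gl2 :: "'a gl2 \<Rightarrow> 'a gl2 \<Rightarrow> 'a gl2" is "(-)" .
lift_definition uminus_gl2 :: "'a gl2 \<Rightarrow> 'a gl2" is uminus .
lift_definition times_gl2 :: "'a gl2 \<Rightarrow> 'a gl2 \<Rightarrow> 'a gl2" is "(**)" .

instance
proof
  fix a b c :: "'a gl2"
  show "a * b * c = a * (b * c)" by transfer (simp add: matrix_mul_assoc)
  show "1 * a = a" by transfer simp
  show "a * 1 = a" by transfer simp
  show "a + b + c = a + (b + c)" by transfer (simp add: add.assoc)
  show "a + b = b + a" by transfer (simp add: add.commute)
  show "0 + a = a" by transfer simp
  show "- a + a = 0" by transfer simp
  show "a - b = a + - b" by transfer simp
  show "(a + b) * c = a * c + b * c"
    by transfer (simp add: matrix_matrix_mult_def vec_eq_iff distrib_right sum.distrib)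
  show "a * (b + c) = a * b + a * c"
    by transfer (simp add: matrix_matrix_mult_def vec_eq_iff distrib_left sum.distrib)
  show "(0 :: 'a gl2) \<noteq> 1" by transfer (auto simp: mat_def vec_eq_iff)
qed

end

lift_definition map_gl2 :: "('r \<Rightarrow> 's) \<Rightarrow> 'r gl2 \<Rightarrow> 's gl2"
  is "\<lambda>f A. \<chi> i j. f (A $ i $ j)" .

definition Q0 :: "(complex \<Rightarrow> 'r::comm_ring_1 \<Rightarrow> 'r) \<Rightarrow> 'r gl2"
  where "Q0 cscale = Gl2 (vector [vector [cscale (- \<i>) 1, 0], vector [0, cscale \<i> 1]])"


section \<open>The loop algebra\<close>

text \<open>Series in \<open>z\<close> with finitely many positive powers are formal Laurent series in
  \<open>z\<^sup>-\<^sup>1\<close>: the variable of \<^type>\<open>fls\<close> stands for \<open>z\<^sup>-\<^sup>1\<close>, and the coefficient of \<open>z ^ i\<close> is the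
  one with index \<open>- i\<close>.\<close>

type_synonym 'r loop = "'r gl2 fls"

definition z_coeff :: "'r::comm_ring_1 loop \<Rightarrow> int \<Rightarrow> 'r gl2"
  where "z_coeff X i = fls_nth X (- i)"

definition Z_series :: "(int \<Rightarrow> 'r::comm_ring_1 gl2) \<Rightarrow> 'r loop"
  where "Z_series F = Abs_fls (\<lambda>n. F (- n))"

lemma z_coeff_Z_series:
  assumes "\<exists>N. \<forall>i>N. F i = 0"
  shows "z_coeff (Z_series F) i = F i"
proof -
  from assms obtain N where "\<forall>i>N. F i = 0" by blast
  then have "\<forall>n< -N. F (- n) = 0" by auto
  then show ?thesis
    unfolding z_coeff_def Z_series_def by (subst nth_Abs_fls_ex_lower_bound) auto
qed

lemma z_coeff_bounded: "\<exists>N. \<forall>i>N. z_coeff X i = 0"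
  unfolding z_coeff_def
  by (rule exI[of _ "- fls_subdegree X"]) simp

lemma loop_eqI: "(\<And>i. z_coeff X i = z_coeff Y i) \<Longrightarrow> X = Y"
  unfolding z_coeff_def by (metis fls_eqI minus_minus)

abbreviation loop_z :: "'r::comm_ring_1 loop"
  where "loop_z \<equiv> fls_X_inv"

lemma z_coeff_loop_z: "z_coeff loop_z i = (if i = 1 then 1 else 0)"
  by (auto simp: z_coeff_def)

lemma z_coeff_mult_loop_z_power: "z_coeff (X * loop_z ^ m) i = z_coeff X (i - int m)"
  unfolding z_coeff_def by (simp add: fls_X_inv_power_times_conv_shift)

lemma z_coeff_mult:
  assumes "\<forall>i>N. z_coeff X i = 0" and "\<forall>i>N'. z_coeff Y i = 0"
  shows "z_coeff (X * Y) k = (\<Sum>i=k-N'..N. z_coeff X i * z_coeff Y (k - i))"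
proof -
  have X: "fls_nth X i = 0" if "i < - N" for i
    using assms(1) that unfolding z_coeff_def by (metis minus_less_iff minus_minus)
  have Y: "fls_nth Y i = 0" if "i < - N'" for i
    using assms(2) that unfolding z_coeff_def by (metis minus_less_iff minus_minus)
  have "z_coeff (X * Y) k =
      (\<Sum>i=fls_subdegree X..-k - fls_subdegree Y. fls_nth X i * fls_nth Y (-k - i))"
    unfolding z_coeff_def by (rule fls_times_nth(2))
  also have "\<dots> = (\<Sum>i=-N..-k+N'. fls_nth X i * fls_nth Y (-k - i))"
  proof (rule sum.mono_neutral_cong)
    fix i assume "i \<in> {-N..-k+N'} - {fls_subdegree X..-k - fls_subdegree Y}"
    then have "i < fls_subdegree X \<or> -k - i < fls_subdegree Y" by auto
    then show "fls_nth X i * fls_nth Y (-k - i) = 0" by auto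
  next
    fix i assume "i \<in> {fls_subdegree X..-k - fls_subdegree Y} - {-N..-k+N'}"
    then have "i < - N \<or> -k - i < - N'" by auto
    then show "fls_nth X i * fls_nth Y (-k - i) = 0" using X Y by auto
  qed auto
  also have "\<dots> = (\<Sum>i=k-N'..N. z_coeff X i * z_coeff Y (k - i))"
    unfolding z_coeff_def
    by (rule sum.reindex_bij_witness[of _ uminus uminus]) auto
  finally show ?thesis .
qed

text \<open>The commutator of the ring of series is the bracket defined coefficientwise by
  \<open>[X_i, Y_j] z ^ (i + j)\<close>.\<close>

lemma z_coeff_commutator:
  assumes "\<forall>i>N. z_coeff X i = 0" and "\<forall>i>N'. z_coeff Y i = 0"
  shows "z_coeff (commutator X Y) k = (\<Sum>i=k-N'..N. commutator (z_coeff X i) (z_coeff Y (k - i)))"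
proof -
  have "z_coeff (Y * X) k = (\<Sum>i=k-N..N'. z_coeff Y i * z_coeff X (k - i))"
    using assms by (intro z_coeff_mult)
  also have "\<dots> = (\<Sum>i=k-N'..N. z_coeff Y (k - i) * z_coeff X i)"
    by (rule sum.reindex_bij_witness[of _ "\<lambda>i. k - i" "\<lambda>i. k - i"]) auto
  finally show ?thesis
    using z_coeff_mult[OF assms, of k]
    by (simp add: commutator_def sum_subtractf) (simp add: z_coeff_def)
qed

definition z_part_ge :: "int \<Rightarrow> 'r::comm_ring_1 loop \<Rightarrow> 'r loop"
  where "z_part_ge k X = Z_series (\<lambda>i. if i \<ge> k then z_coeff X i else 0)"

abbreviation nonneg_part :: "'r::comm_ring_1 loop \<Rightarrow> 'r loop"
  where "nonneg_part \<equiv> z_part_ge 0"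

abbreviation pos_part :: "'r::comm_ring_1 loop \<Rightarrow> 'r loop"
  where "pos_part \<equiv> z_part_ge 1"

lemma z_coeff_z_part_ge: "z_coeff (z_part_ge k X) i = (if i \<ge> k then z_coeff X i else 0)"
  using z_coeff_bounded[of X] unfolding z_part_ge_def
  by (subst z_coeff_Z_series) auto

definition loop_map :: "('r::comm_ring_1 \<Rightarrow> 'r) \<Rightarrow> 'r loop \<Rightarrow> 'r loop"
  where "loop_map f X = Z_series (\<lambda>i. map_gl2 f (z_coeff X i))"

lemma z_coeff_loop_map:
  assumes "f 0 = 0"
  shows "z_coeff (loop_map f X) i = map_gl2 f (z_coeff X i)"
proof -
  have "map_gl2 f 0 = 0" using assms by transfer (simp add: vec_eq_iff)
  then show ?thesis
    using z_coeff_bounded[of X] unfolding loop_map_def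
    by (subst z_coeff_Z_series) metis+
qed

definition G_neg :: "'r::comm_ring_1 loop set"
  where "G_neg = {g. z_coeff g 0 = 1 \<and> (\<forall>i>0. z_coeff g i = 0)}"

lemma G_neg_unit: "g \<in> G_neg \<Longrightarrow> g \<in> unit_set"
proof -
  assume g: "g \<in> G_neg"
  have 0: "fls_nth g 0 = 1" using g by (simp add: G_neg_def z_coeff_def)
  have neg: "fls_nth g n = 0" if "n < 0" for n
  proof -
    have "z_coeff g (- n) = 0" using g that by (simp add: G_neg_def)
    then show ?thesis by (simp add: z_coeff_def)
  qed
  have "fls_subdegree g = 0"
    by (rule fls_subdegree_eqI) (use 0 neg in auto)
  with 0 have "1 * fls_nth g (fls_subdegree g) = 1" "fls_nth g (fls_subdegree g) * 1 = 1" by simp_all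
  from fls_right_inverse[OF this(2)] fls_left_inverse'[OF this]
  show ?thesis by (auto simp: unit_set_def is_inverse_def)
qed


section \<open>The two hierarchies\<close>

definition akns_dressed :: "(complex \<Rightarrow> 'r::comm_ring_1 \<Rightarrow> 'r) \<Rightarrow> 'r loop \<Rightarrow> 'r loop"
  where "akns_dressed cscale g = g * fls_const (Q0 cscale) * ring_inverse g"

definition strict_akns_dressed ::
    "(complex \<Rightarrow> 'r::comm_ring_1 \<Rightarrow> 'r) \<Rightarrow> 'r gl2 \<Rightarrow> 'r loop \<Rightarrow> 'r loop"
  where "strict_akns_dressed cscale K g =
    fls_const K * g * (fls_const (Q0 cscale) * loop_z) * ring_inverse g * fls_const (ring_inverse K)"

definition akns_B :: "'r::comm_ring_1 loop \<Rightarrow> nat \<Rightarrow> 'r loop"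
  where "akns_B Q m = nonneg_part (Q * loop_z ^ m)"

text \<open>Only indices \<open>m \<ge> 1\<close> are used, so the truncated subtraction is harmless.\<close>

definition strict_akns_C :: "'r::comm_ring_1 loop \<Rightarrow> nat \<Rightarrow> 'r loop"
  where "strict_akns_C Z m = pos_part (Z * loop_z ^ (m - 1))"

definition zero_curvature ::
    "(nat \<Rightarrow> 'r::comm_ring_1 \<Rightarrow> 'r) \<Rightarrow> nat set \<Rightarrow> (nat \<Rightarrow> 'r loop) \<Rightarrow> bool"
  where "zero_curvature D M B \<longleftrightarrow> (\<forall>m1\<in>M. \<forall>m2\<in>M.
    loop_map (D m1) (B m2) - loop_map (D m2) (B m1) - commutator (B m1) (B m2) = 0)"

definition akns_solution ::
    "(complex \<Rightarrow> 'r::comm_ring_1 \<Rightarrow> 'r) \<Rightarrow> (nat \<Rightarrow> 'r \<Rightarrow> 'r) \<Rightarrow> 'r loop \<Rightarrow> bool"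
  where "akns_solution cscale D Q \<longleftrightarrow>
    (\<exists>g\<in>G_neg. Q = akns_dressed cscale g) \<and>
    (\<forall>m. loop_map (D m) Q = commutator (akns_B Q m) Q)"

definition strict_akns_solution ::
    "(complex \<Rightarrow> 'r::comm_ring_1 \<Rightarrow> 'r) \<Rightarrow> (nat \<Rightarrow> 'r \<Rightarrow> 'r) \<Rightarrow> 'r loop \<Rightarrow> bool"
  where "strict_akns_solution cscale D Z \<longleftrightarrow>
    (\<exists>K\<in>unit_set. \<exists>g\<in>G_neg. Z = strict_akns_dressed cscale K g) \<and>
    (\<forall>m\<ge>1. loop_map (D m) Z = commutator (strict_akns_C Z m) Z)"

end

theory Submission
  imports Defs
begin

text \<open>Fix \<open>B = B_m\<close> and put \<open>X = \<partial>_m(Q) - [B, Q]\<close>. Since \<open>z\<close> is central and killed by the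
  derivations, \<open>X z ^ n\<close> is the sum of \<open>\<partial>_m(B_n) - [B, B_n]\<close> and the same expression in the
  truncated tail \<open>Q z ^ n - B_n\<close>. The former equals \<open>\<partial>_n(B)\<close> by zero curvature, the latter
  involves only powers of \<open>z\<close> bounded by the degree of \<open>B\<close>; so the degree of \<open>X z ^ n\<close> is bounded
  independently of \<open>n\<close>, which forces \<open>X = 0\<close>. The strict case differs only in the place of
  the truncation.\<close>

lemma z_coeff_add: "z_coeff (X + Y) i = z_coeff X i + z_coeff Y i"
  by (simp add: z_coeff_def)

lemma z_coeff_diff: "z_coeff (X - Y) i = z_coeff X i - z_coeff Y i"
  by (simp add: z_coeff_def)

lemma map_gl2_zero: "f 0 = 0 \<Longrightarrow> map_gl2 f 0 = 0"
  by transfer (simp add: vec_eq_iff)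

lemma map_gl2_add: "Modules.additive f \<Longrightarrow> map_gl2 f (A + B) = map_gl2 f A + map_gl2 f B"
  by transfer (simp add: vec_eq_iff Modules.additive.add)

lemma loop_map_add:
  assumes "Modules.additive f"
  shows "loop_map f (X + Y) = loop_map f X + loop_map f Y"
  by (rule loop_eqI)
    (simp add: z_coeff_loop_map z_coeff_add map_gl2_add assms Modules.additive.zero[OF assms])

lemma loop_map_mult_loop_z_power:
  assumes "f 0 = 0"
  shows "loop_map f (X * loop_z ^ n) = loop_map f X * loop_z ^ n"
  by (rule loop_eqI) (simp add: z_coeff_loop_map z_coeff_mult_loop_z_power assms)

lemma commutator_add_right: "commutator x (y + z) = commutator x y + commutator x z"
  by (simp add: commutator_def algebra_simps)

lemma commutator_mult_loop_z_power:
  "commutator X (Y * loop_z ^ n) = commutator X Y * loop_z ^ n"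
proof -
  \<comment> \<open>Matrix coefficients need not commute, but \<open>loop_z ^ n\<close> acts from
    either side as the same index shift.\<close>
  have "loop_z ^ n * X = X * loop_z ^ n"
    by (simp add: fls_X_inv_power_times_conv_shift)
  then show ?thesis
    by (simp add: commutator_def left_diff_distrib mult.assoc)
qed

text \<open>Serves both hierarchies: \<open>k\<close> is the truncation level and \<open>h n\<close>
  the derivation paired with the truncation of \<open>Q * loop_z ^ n\<close>. As \<open>h n\<close>
  kills 0, \<open>loop_map (h n) B\<close> has at most the degree of \<open>B\<close>, uniformly in
  \<open>n\<close>.\<close>

lemma lax_equation_of_zero_curvature:
  fixes B Q :: "'r::comm_ring_1 loop"
  assumes f: "Modules.additive f"
    and h: "\<And>n. h n 0 = 0"
    and zc: "\<And>n. loop_map f (z_part_ge k (Q * loop_z ^ n)) - loop_map (h n) B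
      - commutator B (z_part_ge k (Q * loop_z ^ n)) = 0"
  shows "loop_map f Q = commutator B Q"
proof (rule loop_eqI)
  fix i
  have f0: "f 0 = 0" using f by (rule Modules.additive.zero)
  obtain N where N: "\<forall>i>N. z_coeff B i = 0"
    using z_coeff_bounded by blast
  \<comment> \<open>Makes \<open>i + int n\<close> exceed \<open>N\<close>, \<open>k - 1\<close> and
    \<open>N + k - 1\<close>, the degree bounds of \<open>B\<close>, of the tail \<open>L\<close>
    and of their commutator.\<close>
  define n where "n = nat (\<bar>N\<bar> + \<bar>k\<bar> + 1 - i)"
  define j where "j = i + int n"
  have j: "j > N" "j \<ge> k" "j - (k - 1) > N"
    unfolding j_def n_def by linarith+
  define P where "P = z_part_ge k (Q * loop_z ^ n)"
  define L where "L = Q * loop_z ^ n - P"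
  have L: "\<forall>i>k - 1. z_coeff L i = 0"
    by (simp add: L_def P_def z_coeff_diff z_coeff_z_part_ge)
  have "(loop_map f Q - commutator B Q) * loop_z ^ n
      = loop_map f (P + L) - commutator B (P + L)"
    by (simp add: L_def left_diff_distrib loop_map_mult_loop_z_power f0
        commutator_mult_loop_z_power)
  also have "\<dots> = loop_map (h n) B + (loop_map f L - commutator B L)"
    using zc[of n]
    by (simp add: loop_map_add f commutator_add_right P_def algebra_simps)
  finally have "z_coeff (loop_map f Q - commutator B Q) i
      = z_coeff (loop_map (h n) B + (loop_map f L - commutator B L)) j"
    using z_coeff_mult_loop_z_power[of "loop_map f Q - commutator B Q" n j]
    by (simp add: j_def)
  \<comment> \<open>The third bound on \<open>j\<close> makes the range
    \<open>{j - (k - 1)..N}\<close> of the commutator sum empty; the other two kill the remaining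
    terms.\<close>
  also have "\<dots> = 0"
    using j N L z_coeff_commutator[OF N L, of j]
    by (simp add: z_coeff_add z_coeff_diff z_coeff_loop_map h f0 map_gl2_zero)
  finally show "z_coeff (loop_map f Q) i = z_coeff (commutator B Q) i"
    by (simp add: z_coeff_diff)
qed

lemma (in commuting_derivations) additive_derivation:
  assumes "m \<in> M"
  shows "Modules.additive (D m)"
proof -
  interpret derivation cscale "D m" using assms by (rule derivation)
  show ?thesis by unfold_locales (rule add)
qed

theorem proposition2p4:
  fixes cscale :: "complex \<Rightarrow> 'r::comm_ring_1 \<Rightarrow> 'r" and D :: "nat \<Rightarrow> 'r \<Rightarrow> 'r"
    and g Q :: "'r loop"
    and cscale' :: "complex \<Rightarrow> 's::comm_ring_1 \<Rightarrow> 's" and D' :: "nat \<Rightarrow> 's \<Rightarrow> 's"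
    and K :: "'s gl2" and g' Z :: "'s loop"
  shows
    "(akns_setting cscale D \<longrightarrow>
        g \<in> G_neg \<longrightarrow> Q = akns_dressed cscale g \<longrightarrow>
        zero_curvature D {0..} (akns_B Q) \<longrightarrow>
        akns_solution cscale D Q) \<and>
     (strict_akns_setting cscale' D' \<longrightarrow>
        K \<in> unit_set \<longrightarrow> g' \<in> G_neg \<longrightarrow> Z = strict_akns_dressed cscale' K g' \<longrightarrow>
        zero_curvature D' {1..} (strict_akns_C Z) \<longrightarrow>
        strict_akns_solution cscale' D' Z)"
proof (intro conjI impI)
  assume "akns_setting cscale D" and g: "g \<in> G_neg" "Q = akns_dressed cscale g"
    and zc: "zero_curvature D {0..} (akns_B Q)"
  then interpret commuting_derivations cscale D "{0..}" by (simp add: akns_setting_def)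
  have add: "Modules.additive (D m)" for m by (rule additive_derivation) simp
  have "loop_map (D m) Q = commutator (akns_B Q m) Q" for m
  proof (rule lax_equation_of_zero_curvature[where h = D and k = 0])
    show "D n 0 = 0" for n using add by (rule Modules.additive.zero)
  qed (use zc add in \<open>auto simp: zero_curvature_def akns_B_def\<close>)
  with g show "akns_solution cscale D Q" by (auto simp: akns_solution_def)
next
  assume "strict_akns_setting cscale' D'" and g: "K \<in> unit_set" "g' \<in> G_neg"
      "Z = strict_akns_dressed cscale' K g'"
    and zc: "zero_curvature D' {1..} (strict_akns_C Z)"
  then interpret commuting_derivations cscale' D' "{1..}" by (simp add: strict_akns_setting_def)
  have add: "Modules.additive (D' m)" if "m \<ge> 1" for m
    using that by (intro additive_derivation) simp
  have "loop_map (D' m) Z = commutator (strict_akns_C Z m) Z" if m: "m \<ge> 1" for m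
  \<comment> \<open>The positive part of \<open>Z * loop_z ^ n\<close> is
    \<open>strict_akns_C Z (Suc n)\<close>, so it pairs with the derivation of index
    \<open>Suc n\<close>.\<close>
  proof (rule lax_equation_of_zero_curvature[where h = "\<lambda>n. D' (Suc n)" and k = 1])
    show "D' (Suc n) 0 = 0" for n using add by (intro Modules.additive.zero) simp
    fix n
    have "loop_map (D' m) (strict_akns_C Z (Suc n)) - loop_map (D' (Suc n)) (strict_akns_C Z m)
        - commutator (strict_akns_C Z m) (strict_akns_C Z (Suc n)) = 0"
      using zc m by (simp add: zero_curvature_def)
    then show "loop_map (D' m) (pos_part (Z * loop_z ^ n))
        - loop_map (D' (Suc n)) (strict_akns_C Z m)
        - commutator (strict_akns_C Z m) (pos_part (Z * loop_z ^ n)) = 0"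
      \<comment> \<open>Unfolded at \<open>Suc n\<close> only: \<open>strict_akns_C Z m\<close> must
        stay intact as \<open>B\<close>.\<close>
      by (simp add: strict_akns_C_def[of Z "Suc n"])
  qed (use add m in auto)
  with g show "strict_akns_solution cscale' D' Z" by (auto simp: strict_akns_solution_def)
qed

end
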